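(* Let $(X,w)$ be a weighted graph and let $R$, $S$ be nontrivial abelian groups. Then $$\tfrac{1}{2}\,\mathrm{cbe}_0(X,w,R)\;\leq\;\mathrm{cbe}_0(X,w,S)\;\leq\;2\,\mathrm{cbe}_0(X,w,R).$$
   Context: A graph is a finite simplicial complex $X$ of dimension at most $1$ (a nonempty finite family of finite sets closed under taking subsets, so $\emptyset\in X$). $X(i)$ denotes the set of faces of dimension $i$ (cardinality $i+1$); $X(0)$ is the set of vertices and $X(1)$ the set of edges. A weighted graph is a pair $(X,w)$ where $X$ is a graph that is pure of dimension $1$ (every face is contained in an edge) and $w:X\to[0,\infty)$ satisfies $\sum_{e\in X(1)}w(e)=1$, $w(v)=\frac12\sum_{e\in X(1),\,e\supseteq v}w(e)$ for all $v\in X(0)$, $w(\emptyset)=1$, and $w(v)>0$ for all $v\in X(0)$. For $A\subseteq X$, $w(A)=\sum_{a\in A}w(a)$. For a nontrivial abelian group $R$, fix a linear order on the vertices and, for an edge $e$, let $e^+$ and $e^-$ be its larger and smaller vertex. Let $C^0=R^{X(0)}$, $C^1=R^{X(1)}$, $(d_0f)(e)=f(e^+)-f(e^-)$, and let $B^0\subseteq C^0$ be the set of constant functions $X(0)\to R$. For $f\in C^i$ put $\|f\|_w=w(\{x\in X(i): f(x)\neq 0\})$ and $\mathrm{dist}_w(f,B^0)=\min_{g\in B^0}\|f-g\|_w$. Then $\mathrm{cbe}_0(X,w,R)$ is the supremum of all $\varepsilon\in[0,\infty)$ such that $\|d_0f\|_w\ge\varepsilon\,\mathrm{dist}_w(f,B^0)$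 for all $f\in C^0$. *)

theory Defs
  imports "HOL-Algebra.Group" "HOL-Library.FuncSet" Complex_Main
begin

definition simplicial_complex :: "'a set set \<Rightarrow> bool" where
  "simplicial_complex X \<longleftrightarrow>
     finite X \<and> X \<noteq> {} \<and> (\<forall>A\<in>X. finite A) \<and> (\<forall>A\<in>X. \<forall>B. B \<subseteq> A \<longrightarrow> B \<in> X)"

text \<open>The vertices are the singletons in \<open>faces X 0\<close>, not the points of the ground type. The
  empty face has dimension \<open>-1\<close> and lies in no \<open>faces X i\<close>.\<close>

definition faces :: "'a set set \<Rightarrow> nat \<Rightarrow> 'a set set" where
  "faces X i = {A \<in> X. card A = i + 1}"

definition graph :: "'a set set \<Rightarrow> bool" where
  "graph X \<longleftrightarrow> simplicial_complex X \<and> (\<forall>A\<in>X. card A \<le> 2)"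

definition pure1 :: "'a set set \<Rightarrow> bool" where
  "pure1 X \<longleftrightarrow> (\<forall>A\<in>X. \<exists>e\<in>faces X 1. A \<subseteq> e)"

definition weighted_graph :: "'a set set \<Rightarrow> ('a set \<Rightarrow> real) \<Rightarrow> bool" where
  "weighted_graph X w \<longleftrightarrow>
     graph X \<and> pure1 X \<and>
     (\<forall>A\<in>X. 0 \<le> w A) \<and>
     (\<Sum>e\<in>faces X 1. w e) = 1 \<and>
     (\<forall>v\<in>faces X 0. w v = 1/2 * (\<Sum>e | e \<in> faces X 1 \<and> v \<subseteq> e. w e)) \<and>
     w {} = 1 \<and>
     (\<forall>v\<in>faces X 0. 0 < w v)"

text \<open>Coefficient groups are written multiplicatively, following HOL-Algebra: \<open>f x - g x\<close> reads
  \<open>f x \<otimes> inv (g x)\<close> and the condition \<open>f x \<noteq> 0\<close> reads \<open>f x \<noteq> \<one>\<close>.\<close>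

definition cochains :: "'a set set \<Rightarrow> ('r, 'm) monoid_scheme \<Rightarrow> nat \<Rightarrow> ('a set \<Rightarrow> 'r) set" where
  "cochains X R i = faces X i \<rightarrow>\<^sub>E carrier R"

definition cochain_diff ::
  "'a set set \<Rightarrow> ('r, 'm) monoid_scheme \<Rightarrow> nat \<Rightarrow> ('a set \<Rightarrow> 'r) \<Rightarrow> ('a set \<Rightarrow> 'r) \<Rightarrow> 'a set \<Rightarrow> 'r"
  where "cochain_diff X R i f g = (\<lambda>x\<in>faces X i. f x \<otimes>\<^bsub>R\<^esub> inv\<^bsub>R\<^esub> (g x))"

text \<open>Here \<open>r\<close> is a linear order on the vertex set, \<open>(x, y) \<in> r\<close> meaning that \<open>x\<close> is at most
  \<open>y\<close>.\<close>

definition larger_vertex :: "'a set set \<Rightarrow> 'a set rel \<Rightarrow> 'a set \<Rightarrow> 'a set" where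
  "larger_vertex X r e =
     (THE x. x \<in> faces X 0 \<and> x \<subseteq> e \<and> (\<forall>y\<in>faces X 0. y \<subseteq> e \<longrightarrow> (y, x) \<in> r))"

definition smaller_vertex :: "'a set set \<Rightarrow> 'a set rel \<Rightarrow> 'a set \<Rightarrow> 'a set" where
  "smaller_vertex X r e =
     (THE x. x \<in> faces X 0 \<and> x \<subseteq> e \<and> (\<forall>y\<in>faces X 0. y \<subseteq> e \<longrightarrow> (x, y) \<in> r))"

definition d0 ::
  "'a set set \<Rightarrow> 'a set rel \<Rightarrow> ('r, 'm) monoid_scheme \<Rightarrow> ('a set \<Rightarrow> 'r) \<Rightarrow> 'a set \<Rightarrow> 'r" where
  "d0 X r R f =
     (\<lambda>e\<in>faces X 1. f (larger_vertex X r e) \<otimes>\<^bsub>R\<^esub> inv\<^bsub>R\<^esub> (f (smaller_vertex X r e)))"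

definition B0 :: "'a set set \<Rightarrow> ('r, 'm) monoid_scheme \<Rightarrow> ('a set \<Rightarrow> 'r) set" where
  "B0 X R = {(\<lambda>x\<in>faces X 0. c) | c. c \<in> carrier R}"

definition wnorm ::
  "'a set set \<Rightarrow> ('a set \<Rightarrow> real) \<Rightarrow> ('r, 'm) monoid_scheme \<Rightarrow> nat \<Rightarrow> ('a set \<Rightarrow> 'r) \<Rightarrow> real" where
  "wnorm X w R i f = sum w {x \<in> faces X i. f x \<noteq> \<one>\<^bsub>R\<^esub>}"

text \<open>The minimum is over a nonempty finite set of values even if \<open>R\<close> is infinite; see
  \<open>dist_values_finite\<close> below.\<close>

definition dist0 ::
  "'a set set \<Rightarrow> ('a set \<Rightarrow> real) \<Rightarrow> ('r, 'm) monoid_scheme \<Rightarrow> ('a set \<Rightarrow> 'r) \<Rightarrow> real" where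
  "dist0 X w R f = Min ((\<lambda>g. wnorm X w R 0 (cochain_diff X R 0 f g)) ` B0 X R)"

definition cbe0_set ::
  "'a set set \<Rightarrow> ('a set \<Rightarrow> real) \<Rightarrow> 'a set rel \<Rightarrow> ('r, 'm) monoid_scheme \<Rightarrow> real set" where
  "cbe0_set X w r R =
     {\<epsilon>. 0 \<le> \<epsilon> \<and> (\<forall>f\<in>cochains X R 0. wnorm X w R 1 (d0 X r R f) \<ge> \<epsilon> * dist0 X w R f)}"

text \<open>A supremum in the reals; \<open>cbe0_set_nonempty\<close> and \<open>cbe0_set_bdd_above\<close> show that it is
  proper for weighted graphs and nontrivial \<open>R\<close>.\<close>

definition cbe0 ::
  "'a set set \<Rightarrow> ('a set \<Rightarrow> real) \<Rightarrow> 'a set rel \<Rightarrow> ('r, 'm) monoid_scheme \<Rightarrow> real" where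
  "cbe0 X w r R = Sup (cbe0_set X w r R)"

lemma dist_values_finite:
  assumes "finite X"
  shows "finite ((\<lambda>g. wnorm X w R 0 (cochain_diff X R 0 f g)) ` B0 X R)"
proof (rule finite_subset)
  show "(\<lambda>g. wnorm X w R 0 (cochain_diff X R 0 f g)) ` B0 X R \<subseteq> sum w ` Pow X"
    by (auto simp: wnorm_def faces_def)
qed (use assms in simp)

lemma B0_nonempty: "comm_group R \<Longrightarrow> B0 X R \<noteq> {}"
  unfolding B0_def comm_group_def using group.is_monoid monoid.one_closed by fastforce

lemma weighted_graph_finite: "weighted_graph X w \<Longrightarrow> finite X"
  by (simp add: weighted_graph_def graph_def simplicial_complex_def)

lemma wnorm_nonneg: "weighted_graph X w \<Longrightarrow> 0 \<le> wnorm X w R i f"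
  unfolding wnorm_def weighted_graph_def by (intro sum_nonneg) (auto simp: faces_def)

lemma cbe0_set_nonempty:
  assumes "weighted_graph X w"
  shows "0 \<in> cbe0_set X w r R"
  using assms by (simp add: cbe0_set_def wnorm_nonneg)

lemma cbe0_set_bdd_above:
  assumes wg: "weighted_graph X w" and R: "comm_group R" and nt: "carrier R \<noteq> {\<one>\<^bsub>R\<^esub>}"
  shows "bdd_above (cbe0_set X w r R)"
proof -
  interpret R: comm_group R by (rule R)
  obtain a where a: "a \<in> carrier R" "a \<noteq> \<one>\<^bsub>R\<^esub>" using nt R.one_closed by blast
  have fin: "finite X" by (rule weighted_graph_finite[OF wg])
  have sc: "{} \<in> X" "\<And>A B. A \<in> X \<Longrightarrow> B \<subseteq> A \<Longrightarrow> B \<in> X"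
    using wg by (auto simp: weighted_graph_def graph_def simplicial_complex_def)
  then obtain e where "e \<in> faces X 1" using wg by (auto simp: weighted_graph_def pure1_def)
  then obtain p q where "p \<noteq> q" "{p, q} \<in> X" by (auto simp: faces_def card_Suc_eq)
  then have uv: "{p} \<in> faces X 0" "{q} \<in> faces X 0" "{p} \<noteq> {q}"
    using sc(2)[of "{p, q}"] by (auto simp: faces_def)
  define f where "f = (\<lambda>x\<in>faces X 0. if x = {p} then a else \<one>\<^bsub>R\<^esub>)"
  have f: "f \<in> cochains X R 0" using a by (auto simp: f_def cochains_def)
  have pos: "0 < wnorm X w R 0 (cochain_diff X R 0 f g)" if g: "g \<in> B0 X R" for g
  proof -
    obtain c where c: "c \<in> carrier R" "g = (\<lambda>x\<in>faces X 0. c)"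
      using g by (auto simp: B0_def)
    have "\<exists>x\<in>faces X 0. cochain_diff X R 0 f g x \<noteq> \<one>\<^bsub>R\<^esub>"
    proof (rule ccontr)
      assume "\<not> ?thesis"
      then have "cochain_diff X R 0 f g {p} = \<one>\<^bsub>R\<^esub>" "cochain_diff X R 0 f g {q} = \<one>\<^bsub>R\<^esub>"
        using uv by auto
      then have "a \<otimes>\<^bsub>R\<^esub> inv\<^bsub>R\<^esub> c = \<one>\<^bsub>R\<^esub>" "inv\<^bsub>R\<^esub> c = \<one>\<^bsub>R\<^esub>"
        using uv c by (auto simp: cochain_diff_def f_def)
      then show False using a c by simp
    qed
    then obtain x where "x \<in> {x \<in> faces X 0. cochain_diff X R 0 f g x \<noteq> \<one>\<^bsub>R\<^esub>}" by blast
    then show ?thesis unfolding wnorm_def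
      by (intro sum_pos) (use wg fin in \<open>auto simp: weighted_graph_def faces_def\<close>)
  qed
  then have d: "0 < dist0 X w R f"
    unfolding dist0_def using dist_values_finite[OF fin] B0_nonempty[OF R, of X] by (subst Min_gr_iff) auto
  show ?thesis
  proof (rule bdd_aboveI)
    fix t assume "t \<in> cbe0_set X w r R"
    then have "t * dist0 X w R f \<le> wnorm X w R 1 (d0 X r R f)" using f by (auto simp: cbe0_set_def)
    then show "t \<le> wnorm X w R 1 (d0 X r R f) / dist0 X w R f"
      using d by (simp add: pos_le_divide_eq)
  qed
qed

end

theory Submission
  imports Defs
begin

text \<open>Two-valued cochains with coefficients in any nontrivial group see exactly the cuts
  \<open>(A, V - A)\<close> of the vertex set \<open>V\<close>, so every \<open>\<epsilon>\<close> admissible for one group is a Cheeger constant: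
  the cut of \<open>A\<close> has weight at least \<open>\<epsilon> * min (w A) (w (V - A))\<close>. Conversely, let \<open>f\<close> be a cochain
  with values in another group. If a level set of \<open>f\<close> carries at least half of the vertex weight,
  its cut alone bounds the norm of the coboundary of \<open>f\<close>. Otherwise sum the Cheeger inequality over
  all level sets; each edge on which \<open>f\<close> varies is counted twice, which costs the factor 2.\<close>

text \<open>The condition is an exclusive or, so it is symmetric in the two endpoints. Naming them
  through the order matches the form of \<open>d0\<close>.\<close>

definition vertex_cut :: "'a set set \<Rightarrow> 'a set rel \<Rightarrow> 'a set set \<Rightarrow> 'a set set" where
  "vertex_cut X r A = {e \<in> faces X 1. larger_vertex X r e \<in> A \<longleftrightarrow> smaller_vertex X r e \<notin> A}"

lemma finite_faces: "weighted_graph X w \<Longrightarrow> finite (faces X i)"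
  using weighted_graph_finite[of X w] by (simp add: faces_def)

lemma weight_nonneg: "weighted_graph X w \<Longrightarrow> x \<in> faces X i \<Longrightarrow> 0 \<le> w x"
  by (simp add: weighted_graph_def faces_def)

lemma edge_vertices:
  assumes "weighted_graph X w" "e \<in> faces X 1"
  obtains x y where "x \<in> faces X 0" "y \<in> faces X 0" "{v \<in> faces X 0. v \<subseteq> e} = {x, y}"
proof -
  obtain p q where e: "e = {p, q}" "e \<in> X"
    using assms(2) by (auto simp: faces_def card_Suc_eq)
  have "\<And>A B. A \<in> X \<Longrightarrow> B \<subseteq> A \<Longrightarrow> B \<in> X"
    using assms(1) by (auto simp: weighted_graph_def graph_def simplicial_complex_def)
  then have "{p} \<in> X" "{q} \<in> X" using e by blast+
  then have "{p} \<in> faces X 0" "{q} \<in> faces X 0" "{v \<in> faces X 0. v \<subseteq> e} = {{p}, {q}}"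
    using e by (auto simp: faces_def card_1_singleton_iff)
  then show ?thesis using that by blast
qed

text \<open>Both vertices are given by \<open>THE\<close>, so existence and uniqueness must come
  first: totality of \<open>r\<close> orders the two vertices of \<open>e\<close>, antisymmetry
  makes the extremal one unique.\<close>

lemma
  assumes "weighted_graph X w" "linear_order_on (faces X 0) r" "e \<in> faces X 1"
  shows larger_vertex_in_faces: "larger_vertex X r e \<in> faces X 0"
    and smaller_vertex_in_faces: "smaller_vertex X r e \<in> faces X 0"
proof -
  have ord: "refl_on (faces X 0) r" "antisym r" "total_on (faces X 0) r"
    using assms(2) by (auto simp: linear_order_on_def partial_order_on_def preorder_on_def)
  obtain x y where xy: "x \<in> faces X 0" "y \<in> faces X 0" "{v \<in> faces X 0. v \<subseteq> e} = {x, y}"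
    using edge_vertices[OF assms(1,3)] .
  have refl: "(x, x) \<in> r" "(y, y) \<in> r" using refl_onD[OF ord(1)] xy by auto
  \<comment> \<open>Totality compares only distinct elements; \<open>edge_vertices\<close> leaves
    \<open>x = y\<close> open, and reflexivity covers it.\<close>
  then have xy_yx: "(x, y) \<in> r \<or> (y, x) \<in> r" using ord(3) xy by (cases "x = y") (auto simp: total_on_def)
  \<comment> \<open>Rename the two vertices so that \<open>u\<close> is the lower one.\<close>
  then obtain u v where uv: "u \<in> faces X 0" "v \<in> faces X 0" "{v \<in> faces X 0. v \<subseteq> e} = {u, v}"
    "(u, v) \<in> r" "(u, u) \<in> r" "(v, v) \<in> r"
  proof (cases "(x, y) \<in> r")
    case True
    then show ?thesis using that[of x y] xy refl by blast
  next
    case False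
    moreover have "{v \<in> faces X 0. v \<subseteq> e} = {y, x}" unfolding xy(3) by (rule insert_commute)
    ultimately show ?thesis using that[of y x] xy(1,2) refl xy_yx by blast
  qed
  have iff: "z \<in> faces X 0 \<and> z \<subseteq> e \<longleftrightarrow> z = u \<or> z = v" for z using uv(3) by blast
  have bounds: "(t, v) \<in> r" "(u, t) \<in> r" if "t \<in> faces X 0" "t \<subseteq> e" for t
    using iff[of t] that uv(4-6) by auto
  have sub: "u \<subseteq> e" "v \<subseteq> e" using iff by auto
  have "larger_vertex X r e = v"
    unfolding larger_vertex_def
  proof (rule the_equality)
    fix z assume z: "z \<in> faces X 0 \<and> z \<subseteq> e \<and> (\<forall>t\<in>faces X 0. t \<subseteq> e \<longrightarrow> (t, z) \<in> r)"
    then have "(v, z) \<in> r" "z = u \<or> z = v" using iff by blast+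
    then show "z = v" using antisymD[OF ord(2)] uv(4) by blast
  qed (use uv(1,2) sub bounds in auto)
  then show "larger_vertex X r e \<in> faces X 0" using uv(2) by simp
  have "smaller_vertex X r e = u"
    unfolding smaller_vertex_def
  proof (rule the_equality)
    fix z assume z: "z \<in> faces X 0 \<and> z \<subseteq> e \<and> (\<forall>t\<in>faces X 0. t \<subseteq> e \<longrightarrow> (z, t) \<in> r)"
    then have "(z, u) \<in> r" "z = u \<or> z = v" using iff by blast+
    then show "z = u" using antisymD[OF ord(2)] uv(4) by blast
  qed (use uv(1,2) sub bounds in auto)
  then show "smaller_vertex X r e \<in> faces X 0" using uv(1) by simp
qed

lemma (in group) mult_inv_eq_one_iff:
  "x \<in> carrier G \<Longrightarrow> y \<in> carrier G \<Longrightarrow> x \<otimes> inv y = \<one> \<longleftrightarrow> x = y"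
  by (simp add: inv_solve_right')

text \<open>In a group a quotient is trivial iff its two terms agree. Hence the norm sees only where
  \<open>f\<close> changes along an edge, and the group operation drops out.\<close>

lemma wnorm_d0:
  assumes "weighted_graph X w" "linear_order_on (faces X 0) r" "comm_group R" "f \<in> cochains X R 0"
  shows "wnorm X w R 1 (d0 X r R f) =
    sum w {e \<in> faces X 1. f (larger_vertex X r e) \<noteq> f (smaller_vertex X r e)}"
proof -
  interpret R: comm_group R by (rule assms(3))
  have "f x \<in> carrier R" if "x \<in> faces X 0" for x
    using assms(4) that by (auto simp: cochains_def)
  then have "d0 X r R f e = \<one>\<^bsub>R\<^esub> \<longleftrightarrow> f (larger_vertex X r e) = f (smaller_vertex X r e)"
    if "e \<in> faces X 1" for e
    using larger_vertex_in_faces[OF assms(1,2) that] smaller_vertex_in_faces[OF assms(1,2) that] that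
    by (simp add: d0_def R.mult_inv_eq_one_iff)
  then have "{e \<in> faces X 1. d0 X r R f e \<noteq> \<one>\<^bsub>R\<^esub>} =
      {e \<in> faces X 1. f (larger_vertex X r e) \<noteq> f (smaller_vertex X r e)}"
    by blast
  then show ?thesis by (simp add: wnorm_def)
qed

lemma wnorm_diff_const:
  assumes "comm_group R" "f \<in> cochains X R 0" "c \<in> carrier R"
  shows "wnorm X w R 0 (cochain_diff X R 0 f (\<lambda>x\<in>faces X 0. c)) = sum w {x \<in> faces X 0. f x \<noteq> c}"
proof -
  interpret R: comm_group R by (rule assms(1))
  have "f x \<in> carrier R" if "x \<in> faces X 0" for x
    using assms(2) that by (auto simp: cochains_def)
  then have "{x \<in> faces X 0. cochain_diff X R 0 f (\<lambda>x\<in>faces X 0. c) x \<noteq> \<one>\<^bsub>R\<^esub>} =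
      {x \<in> faces X 0. f x \<noteq> c}"
    using assms(3) by (auto simp: cochain_diff_def R.mult_inv_eq_one_iff)
  then show ?thesis by (simp add: wnorm_def)
qed

text \<open>With \<open>dist0_geI\<close> this replaces the \<open>Min\<close> over
  \<open>B0\<close> by comparison with single constants.\<close>

lemma dist0_le:
  assumes "weighted_graph X w" "comm_group R" "f \<in> cochains X R 0" "c \<in> carrier R"
  shows "dist0 X w R f \<le> sum w {x \<in> faces X 0. f x \<noteq> c}"
  unfolding dist0_def wnorm_diff_const[OF assms(2-4), symmetric]
  by (rule Min_le[OF dist_values_finite[OF weighted_graph_finite[OF assms(1)]]])
    (use assms(4) in \<open>auto simp: B0_def\<close>)

lemma dist0_geI:
  assumes "weighted_graph X w" "comm_group R" "f \<in> cochains X R 0"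
    and "\<And>c. c \<in> carrier R \<Longrightarrow> m \<le> sum w {x \<in> faces X 0. f x \<noteq> c}"
  shows "m \<le> dist0 X w R f"
  unfolding dist0_def
proof (subst Min_ge_iff)
  show "\<forall>a\<in>(\<lambda>g. wnorm X w R 0 (cochain_diff X R 0 f g)) ` B0 X R. m \<le> a"
    using assms(4) by (auto simp: B0_def wnorm_diff_const[OF assms(2,3)])
qed (use dist_values_finite[OF weighted_graph_finite[OF assms(1)]] B0_nonempty[OF assms(2)] in auto)

text \<open>Test \<open>\<epsilon>\<close> on the cochain equal to some \<open>a\<close> other than
  the unit on \<open>A\<close> and to the unit elsewhere: its coboundary is supported on the cut of
  \<open>A\<close>.\<close>

lemma cheeger_of_cbe0_set:
  assumes wg: "weighted_graph X w" and r: "linear_order_on (faces X 0) r"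
    and R: "comm_group R" and nt: "carrier R \<noteq> {\<one>\<^bsub>R\<^esub>}"
    and eps: "\<epsilon> \<in> cbe0_set X w r R" and A: "A \<subseteq> faces X 0"
  shows "\<epsilon> * min (sum w A) (sum w (faces X 0 - A)) \<le> sum w (vertex_cut X r A)"
proof -
  interpret R: comm_group R by (rule R)
  obtain a where a: "a \<in> carrier R" "a \<noteq> \<one>\<^bsub>R\<^esub>" using nt R.one_closed by blast
  define f where "f = (\<lambda>x\<in>faces X 0. if x \<in> A then a else \<one>\<^bsub>R\<^esub>)"
  have f: "f \<in> cochains X R 0" using a by (auto simp: f_def cochains_def)
  have dist: "min (sum w A) (sum w (faces X 0 - A)) \<le> dist0 X w R f"
  proof (rule dist0_geI[OF wg R f])
    fix c
    \<comment> \<open>A constant \<open>c\<close> cannot equal both values of \<open>f\<close>, so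
      \<open>f\<close> differs from it on all of \<open>A\<close> or on all of the
      complement.\<close>
    have "A \<subseteq> {x \<in> faces X 0. f x \<noteq> c} \<or> faces X 0 - A \<subseteq> {x \<in> faces X 0. f x \<noteq> c}"
      using a A by (auto simp: f_def)
    then have "sum w A \<le> sum w {x \<in> faces X 0. f x \<noteq> c} \<or>
        sum w (faces X 0 - A) \<le> sum w {x \<in> faces X 0. f x \<noteq> c}"
      using finite_faces[OF wg, of 0] weight_nonneg[OF wg, of _ 0]
      by (elim disjE) (auto intro!: sum_mono2)
    then show "min (sum w A) (sum w (faces X 0 - A)) \<le> sum w {x \<in> faces X 0. f x \<noteq> c}"
      by linarith
  qed
  have "{e \<in> faces X 1. f (larger_vertex X r e) \<noteq> f (smaller_vertex X r e)} = vertex_cut X r A"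
    using a larger_vertex_in_faces[OF wg r] smaller_vertex_in_faces[OF wg r]
    by (auto simp: f_def vertex_cut_def)
  then have "\<epsilon> * dist0 X w R f \<le> sum w (vertex_cut X r A)"
    using eps f wnorm_d0[OF wg r R f] by (auto simp: cbe0_set_def)
  moreover have "\<epsilon> * min (sum w A) (sum w (faces X 0 - A)) \<le> \<epsilon> * dist0 X w R f"
    using dist eps by (intro mult_left_mono) (auto simp: cbe0_set_def)
  ultimately show ?thesis by linarith
qed

text \<open>Double counting: an edge with distinct end values is cut by exactly the two level sets
  of these values, any other edge by none.\<close>

lemma sum_vertex_cut_level_sets:
  assumes wg: "weighted_graph X w" and r: "linear_order_on (faces X 0) r"
  shows "(\<Sum>c\<in>f ` faces X 0. sum w (vertex_cut X r {x \<in> faces X 0. f x = c})) =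
    2 * sum w {e \<in> faces X 1. f (larger_vertex X r e) \<noteq> f (smaller_vertex X r e)}"
    (is "?L = _")
proof -
  let ?p = "larger_vertex X r" and ?q = "smaller_vertex X r"
  let ?C = "\<lambda>c. vertex_cut X r {x \<in> faces X 0. f x = c}"
  have fin: "finite (faces X i)" for i by (rule finite_faces[OF wg])
  \<comment> \<open>Indicators make the range of the inner sum independent of \<open>c\<close>, so
    that the sums can be exchanged.\<close>
  have "?L = (\<Sum>c\<in>f ` faces X 0. \<Sum>e\<in>faces X 1. if e \<in> ?C c then w e else 0)"
    by (intro sum.cong refl sum.inter_restrict[OF fin, symmetric, THEN trans] arg_cong2[of _ _ _ _ sum])
      (auto simp: vertex_cut_def fin sum.If_cases intro!: arg_cong2[of _ _ _ _ sum])
  also have "\<dots> = (\<Sum>e\<in>faces X 1. \<Sum>c\<in>f ` faces X 0. if e \<in> ?C c then w e else 0)"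
    by (rule sum.swap)
  also have "\<dots> = (\<Sum>e\<in>faces X 1. if f (?p e) \<noteq> f (?q e) then 2 * w e else 0)"
  proof (rule sum.cong[OF refl])
    fix e assume e: "e \<in> faces X 1"
    have pq: "?p e \<in> faces X 0" "?q e \<in> faces X 0"
      using larger_vertex_in_faces[OF wg r e] smaller_vertex_in_faces[OF wg r e] .
    have "(\<Sum>c\<in>f ` faces X 0. if e \<in> ?C c then w e else 0) =
        sum (\<lambda>_. w e) {c \<in> f ` faces X 0. e \<in> ?C c}"
      by (rule sum.inter_filter[symmetric]) (simp add: fin)
    also have "{c \<in> f ` faces X 0. e \<in> ?C c} = (if f (?p e) \<noteq> f (?q e) then {f (?p e), f (?q e)} else {})"
      using e pq by (auto simp: vertex_cut_def)
    finally show "(\<Sum>c\<in>f ` faces X 0. if e \<in> ?C c then w e else 0) =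
        (if f (?p e) \<noteq> f (?q e) then 2 * w e else 0)" by auto
  qed
  also have "\<dots> = 2 * sum w {e \<in> faces X 1. f (?p e) \<noteq> f (?q e)}"
    using fin by (simp add: sum.inter_filter[symmetric] sum_distrib_left)
  finally show ?thesis .
qed

text \<open>The transfer is made for each admissible \<open>\<epsilon>\<close>, so no question
  arises whether the supremum is attained.\<close>

lemma half_in_cbe0_set:
  assumes wg: "weighted_graph X w" and r: "linear_order_on (faces X 0) r"
    and R: "comm_group R" and nt: "carrier R \<noteq> {\<one>\<^bsub>R\<^esub>}" and S: "comm_group S"
    and eps: "\<epsilon> \<in> cbe0_set X w r R"
  shows "\<epsilon> / 2 \<in> cbe0_set X w r S"
proof -
  interpret S: comm_group S by (rule S)
  have eps0: "0 \<le> \<epsilon>" using eps by (simp add: cbe0_set_def)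
  have fin: "finite (faces X i)" for i by (rule finite_faces[OF wg])
  have pos: "0 \<le> w x" if "x \<in> faces X i" for x i by (rule weight_nonneg[OF wg that])
  have "\<epsilon> / 2 * dist0 X w S f \<le> wnorm X w S 1 (d0 X r S f)" if f: "f \<in> cochains X S 0" for f
  proof -
    let ?V = "faces X 0"
    let ?D = "{e \<in> faces X 1. f (larger_vertex X r e) \<noteq> f (smaller_vertex X r e)}"
    define L where "L c = {x \<in> ?V. f x = c}" for c
    have cheeger: "\<epsilon> * min (sum w (L c)) (sum w (?V - L c)) \<le> sum w (vertex_cut X r (L c))" for c
      by (rule cheeger_of_cbe0_set[OF wg r R nt eps]) (auto simp: L_def)
    have compl: "sum w (?V - L c) = sum w ?V - sum w (L c)" for c
      using fin by (intro sum_diff) (auto simp: L_def)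
    have D0: "0 \<le> sum w ?D" using pos by (intro sum_nonneg) auto
    have "\<epsilon> * dist0 X w S f \<le> 2 * sum w ?D"
    \<comment> \<open>One half is the threshold at which the minimum in \<open>cheeger\<close>
      switches from the level set to its complement.\<close>
    proof (cases "\<exists>c\<in>f ` ?V. sum w ?V \<le> 2 * sum w (L c)")
      case True
      then obtain c where c: "c \<in> f ` ?V" "sum w ?V \<le> 2 * sum w (L c)" by blast
      have "c \<in> carrier S" using c f by (auto simp: cochains_def PiE_mem)
      then have "dist0 X w S f \<le> sum w {x \<in> ?V. f x \<noteq> c}" by (rule dist0_le[OF wg S f])
      also have "{x \<in> ?V. f x \<noteq> c} = ?V - L c" by (auto simp: L_def)
      finally have "\<epsilon> * dist0 X w S f \<le> \<epsilon> * sum w (?V - L c)"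
        using eps0 by (rule mult_left_mono)
      also have "\<dots> \<le> sum w (vertex_cut X r (L c))"
        using cheeger[of c] c(2) compl[of c] by (simp add: min.absorb2)
      also have "\<dots> \<le> sum w ?D"
      proof (rule sum_mono2)
        \<comment> \<open>Of the endpoints of a cut edge exactly one has the value \<open>c\<close>,
          so the values differ.\<close>
        show "vertex_cut X r (L c) \<subseteq> ?D"
          using larger_vertex_in_faces[OF wg r] smaller_vertex_in_faces[OF wg r]
          by (auto simp: vertex_cut_def L_def)
      qed (use fin pos in auto)
      finally show ?thesis using D0 by linarith
    next
      case False
      \<comment> \<open>The crude bound by the total weight suffices here, since the level sets
        partition \<open>?V\<close> and each one is the lighter side of its cut.\<close>
      have "dist0 X w S f \<le> sum w {x \<in> ?V. f x \<noteq> \<one>\<^bsub>S\<^esub>}"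
        by (rule dist0_le[OF wg S f]) simp
      also have "\<dots> \<le> sum w ?V" using fin pos by (intro sum_mono2) auto
      finally have "\<epsilon> * dist0 X w S f \<le> \<epsilon> * sum w ?V"
        using eps0 by (rule mult_left_mono)
      also have "sum w ?V = (\<Sum>c\<in>f ` ?V. sum w (L c))"
        unfolding L_def by (rule sum.image_gen[OF fin])
      also have "\<epsilon> * (\<Sum>c\<in>f ` ?V. sum w (L c)) \<le> (\<Sum>c\<in>f ` ?V. sum w (vertex_cut X r (L c)))"
      proof (subst sum_distrib_left, rule sum_mono)
        fix c assume "c \<in> f ` ?V"
        then have "2 * sum w (L c) < sum w ?V" using False by force
        then show "\<epsilon> * sum w (L c) \<le> sum w (vertex_cut X r (L c))"
          using cheeger[of c] compl[of c] by (simp add: min.absorb1)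
      qed
      also have "\<dots> = 2 * sum w ?D"
        unfolding L_def by (rule sum_vertex_cut_level_sets[OF wg r])
      finally show ?thesis .
    qed
    then show ?thesis using wnorm_d0[OF wg r S f] by simp
  qed
  then show ?thesis using eps0 by (simp add: cbe0_set_def)
qed

text \<open>Halving maps the admissible set of \<open>R\<close> into that of \<open>S\<close>, which
  is bounded above because \<open>S\<close> is nontrivial. Exchanging \<open>R\<close> and
  \<open>S\<close> gives the other inequality of the theorem.\<close>

lemma cbe0_le_twice:
  assumes wg: "weighted_graph X w" and "linear_order_on (faces X 0) r"
    and "comm_group R" "carrier R \<noteq> {\<one>\<^bsub>R\<^esub>}" and S: "comm_group S" "carrier S \<noteq> {\<one>\<^bsub>S\<^esub>}"
  shows "cbe0 X w r R \<le> 2 * cbe0 X w r S"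
  unfolding cbe0_def
proof (rule cSup_least)
  show "cbe0_set X w r R \<noteq> {}" using cbe0_set_nonempty[OF wg] by blast
next
  fix \<epsilon> assume "\<epsilon> \<in> cbe0_set X w r R"
  then have "\<epsilon> / 2 \<in> cbe0_set X w r S" by (rule half_in_cbe0_set[OF assms(1-5)])
  then have "\<epsilon> / 2 \<le> Sup (cbe0_set X w r S)"
    using cbe0_set_bdd_above[OF wg S] by (rule cSup_upper)
  then show "\<epsilon> \<le> 2 * Sup (cbe0_set X w r S)" by simp
qed

theorem corollary5p4:
  fixes X :: "'a set set" and w :: "'a set \<Rightarrow> real" and r :: "'a set rel"
    and R :: "('r, 'm) monoid_scheme" and S :: "('s, 'n) monoid_scheme"
  assumes "weighted_graph X w"
    and "linear_order_on (faces X 0) r"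
    and "comm_group R" and "carrier R \<noteq> {\<one>\<^bsub>R\<^esub>}"
    and "comm_group S" and "carrier S \<noteq> {\<one>\<^bsub>S\<^esub>}"
  shows "1/2 * cbe0 X w r R \<le> cbe0 X w r S \<and> cbe0 X w r S \<le> 2 * cbe0 X w r R"
  using cbe0_le_twice[OF assms] cbe0_le_twice[OF assms(1,2,5,6,3,4)] by simp

end
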